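(* The sequence $\{\sigma^+(n)\}_{n=1}^\infty$ contains infinitely many arithmetic progressions of length $3$; that is, there are infinitely many pairs $(x,d)$ of positive integers such that each of $x$, $x+d$, $x+2d$ is a term of the sequence, i.e. $x=\sigma^+(a)$, $x+d=\sigma^+(b)$, $x+2d=\sigma^+(c)$ for some positive integers $a,b,c$.
   Context: For a positive integer $n$, $\sigma(n)$ is the sum of the positive divisors of $n$, and $v_p(n)$ is the exponent of the highest power of the prime $p$ dividing $n$. The function $\sigma^+$ is defined on positive integers by $\sigma^+(1)=1$ and $\sigma^+(n)=\prod_{p\mid n}\left(\sigma(p^{v_p(n)})+1\right)$ for $n\ge 2$, the product being over the distinct primes $p$ dividing $n$. *)

theory Defs
  imports "HOL-Computational_Algebra.Primes"
begin

definition divisor_sum :: "nat \<Rightarrow> nat" where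
  "divisor_sum n = (\<Sum>d | d dvd n. d)"

(* Only positive arguments are meaningful. For n = 1 the product is empty, which gives
   the prescribed value 1. *)
definition sigma_plus :: "nat \<Rightarrow> nat" where
  "sigma_plus n = (\<Prod>p\<in>prime_factors n. divisor_sum (p ^ multiplicity p n) + 1)"

lemma sigma_plus_1: "sigma_plus 1 = 1"
  by (simp add: sigma_plus_def)

end

theory Submission
  imports Defs
begin

text \<open>
  Since \<open>\<sigma>\<^sup>+(2\<^sup>k) = 2\<^sup>k\<^sup>+\<^sup>1\<close> for \<open>k > 0\<close> and \<open>\<sigma>\<^sup>+(p) = p + 2\<close> for a prime \<open>p\<close>, the primes
  3, 5, 7 in arithmetic progression give the progression
  \<open>\<sigma>\<^sup>+(2\<^sup>k \<cdot> 3), \<sigma>\<^sup>+(2\<^sup>k \<cdot> 5), \<sigma>\<^sup>+(2\<^sup>k \<cdot> 7)\<close> with difference \<open>2\<^sup>k\<^sup>+\<^sup>2\<close>, for every \<open>k > 0\<close>.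
\<close>

lemma divisor_sum_prime_power:
  assumes "prime p"
  shows "divisor_sum (p ^ k) = (\<Sum>i\<le>k. p ^ i)"
proof -
  have "{d. d dvd p ^ k} = (\<lambda>i. p ^ i) ` {..k}"
    using divides_primepow_nat[OF assms] by auto
  moreover have "inj_on (\<lambda>i. p ^ i) {..k}"
    using prime_gt_1_nat[OF assms] by (auto intro!: inj_onI)
  ultimately show ?thesis
    by (simp add: divisor_sum_def sum.reindex)
qed

text \<open>The geometric sum is one short of a power of 2, so the extra 1 in
  \<open>sigma_plus\<close> completes it.\<close>

lemma divisor_sum_power_2: "divisor_sum (2 ^ k) + 1 = 2 ^ Suc k"
proof -
  have "(\<Sum>i\<le>k. (2::nat) ^ i) + 1 = 2 ^ Suc k"
    by (induction k) auto
  then show ?thesis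
    by (simp only: divisor_sum_prime_power[OF two_is_prime_nat])
qed

lemma divisor_sum_prime:
  assumes "prime p"
  shows "divisor_sum p = p + 1"
  using divisor_sum_prime_power[OF assms, of 1] by simp

text \<open>The product has one factor for 2 and one for \<open>q\<close>; for \<open>k = 0\<close>
  the factor at 2 would be absent.\<close>

lemma sigma_plus_power_2_times_prime:
  assumes "prime q" "q \<noteq> 2" "k > 0"
  shows "sigma_plus (2 ^ k * q) = 2 ^ Suc k * (q + 2)"
proof -
  have "q > 0"
    using assms(1) by (rule prime_gt_0_nat)
  have "prime_factors (2 ^ k * q) = {2, q}"
    using assms \<open>q > 0\<close>
    by (auto simp: in_prime_factors_iff prime_dvd_mult_iff prime_dvd_power_iff primes_dvd_imp_eq)
  moreover have "multiplicity 2 (2 ^ k * q) = k"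
    using assms \<open>q > 0\<close>
    by (simp add: prime_elem_multiplicity_mult_distrib prime_multiplicity_other)
  moreover have "multiplicity q (2 ^ k * q) = 1"
    using assms \<open>q > 0\<close>
    by (simp add: prime_elem_multiplicity_mult_distrib prime_elem_multiplicity_power_distrib
        prime_multiplicity_other)
  ultimately have "sigma_plus (2 ^ k * q) = (divisor_sum (2 ^ k) + 1) * (divisor_sum q + 1)"
    using assms by (simp add: sigma_plus_def)
  then show ?thesis
    using assms by (simp only: divisor_sum_power_2 divisor_sum_prime) simp
qed

theorem theorem2p6:
  shows "infinite {(x :: nat, d :: nat). x > 0 \<and> d > 0 \<and>
    (\<exists>a b c :: nat. a > 0 \<and> b > 0 \<and> c > 0 \<and>
      x = sigma_plus a \<and> x + d = sigma_plus b \<and> x + 2 * d = sigma_plus c)}"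
    (is "infinite ?S")
proof -
  \<comment> \<open>The exponent of 2 in the arguments is \<open>Suc k\<close>, hence positive. The
    cofactors 3 + 2, 5 + 2, 7 + 2 have common gap 2, which adds one more power of 2 to the
    difference.\<close>
  define f :: "nat \<Rightarrow> nat \<times> nat" where "f k = (2 ^ Suc (Suc k) * 5, 2 ^ Suc (Suc (Suc k)))" for k
  have primes: "prime (3::nat)" "prime (5::nat)" "prime (7::nat)"
    by simp_all
  have "f k \<in> ?S" for k
  proof -
    have "sigma_plus (2 ^ Suc k * 3) = 2 ^ Suc (Suc k) * 5"
      "sigma_plus (2 ^ Suc k * 5) = 2 ^ Suc (Suc k) * 7"
      "sigma_plus (2 ^ Suc k * 7) = 2 ^ Suc (Suc k) * 9"
      using primes by (simp_all only: sigma_plus_power_2_times_prime) simp_all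
    then show ?thesis
      unfolding f_def
      by (intro CollectI case_prodI conjI exI[of _ "2 ^ Suc k * 3"] exI[of _ "2 ^ Suc k * 5"]
          exI[of _ "2 ^ Suc k * 7"]) simp_all
  qed
  then have "range f \<subseteq> ?S"
    by (rule image_subsetI)
  moreover have "infinite (range f)"
    \<comment> \<open>Distinct \<open>k\<close> give distinct powers of 2, so \<open>f\<close> is
      injective.\<close>
    using infinite_UNIV_nat by (subst finite_image_iff) (auto simp: inj_def f_def)
  ultimately show ?thesis
    by (rule infinite_super)
qed

end
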